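(* Let $\mathcal{A}$ be a Rickart *-ring and $b\in\mathcal{A}$. Put $b_r=\mathrm{rp}(b)\,b$. Then: (a) the poset $[0,b]^{*|\ell\square}=\{a\in\mathcal{A}: a\preceq^{*|\ell\square} b\}$ is order-isomorphic to $E_b^{*|\ell\square}=\{p\in E(\mathcal{A}): p\le\mathrm{rp}(b),\ pb^*b=b^*bp,\ pb_rp=pb_r\}$; (b) the poset $[0,b]^{*|r\square}=\{a\in\mathcal{A}: a\preceq^{*|r\square} b\}$ is order-isomorphic to $E_b^{*|r\square}=\{p\in E(\mathcal{A}): p\le\mathrm{rp}(b),\ pb^*b=b^*bp,\ pb_rp=b_rp\}$; (c) the poset $[0,b]^{*|\square}=\{a\in\mathcal{A}: a\preceq^{*|\square} b\}$ is order-isomorphic to $E_b^{*|\square}=\{p\in E(\mathcal{A}): p\le\mathrm{rp}(b),\ pb^*b=b^*bp,\ pb_r=b_rp\}$. Here each $[0,b]^{\alpha}$ is ordered by the corresponding $\preceq^{\alpha}$ and each $E_b^{\alpha}$ is ordered by $\le$.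
   Context: A *-ring is an (associative) ring $\mathcal{A}$ with an involution $*$: $(a+b)^*=a^*+b^*$, $(ab)^*=b^*a^*$, $(a^* )^*=a$. It is a Rickart *-ring if for every $a\in\mathcal{A}$ there is a self-adjoint idempotent $p$ (i.e. $p=p^*=p^2$) with $\{x\in\mathcal{A}: xa=0\}=\mathcal{A}(1-p)$; such a ring has an identity $1$, and $p$ is unique and denoted $\mathrm{lp}(a)$. Likewise, for every $a$ there is a unique self-adjoint idempotent $\mathrm{rp}(a)$ with $\{x\in\mathcal{A}: ax=0\}=(1-\mathrm{rp}(a))\mathcal{A}$. $E(\mathcal{A})$ is the set of self-adjoint idempotents, partially ordered by $p\le q$ iff $p=pq$. The following are partial orders on $\mathcal{A}$: $a\preceq^{*|\ell\square} b$ iff $\mathrm{lp}(a)b=a=b\,\mathrm{rp}(a)$ and $a^2=ab$; $a\preceq^{*|r\square} b$ iff $\mathrm{lp}(a)b=a=b\,\mathrm{rp}(a)$ and $a^2=ba$; $a\preceq^{*|\square} b$ iff $\mathrm{lp}(a)b=a=b\,\mathrm{rp}(a)$ and $a^2=ab=ba$. Two posets are order-isomorphic if there is a bijection between them which is order-preserving with order-preserving inverse. *)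

theory Defs
  imports Main
begin

class star_ring = ring +
  fixes star :: "'a \<Rightarrow> 'a"
  assumes star_add: "star (a + b) = star a + star b"
    and star_mult: "star (a * b) = star b * star a"
    and star_star: "star (star a) = a"

definition projections :: "'a::star_ring set" where
  "projections = {p. p = star p \<and> p = p * p}"

definition proj_le :: "'a::star_ring \<Rightarrow> 'a \<Rightarrow> bool" where
  "proj_le p q \<longleftrightarrow> p = p * q"

(* The identity is needed to make sense of A(1 - p).  It is added through monoid_mult rather
   than ring_1, because ring_1 would exclude the zero ring. *)
class rickart_star_ring = star_ring + monoid_mult +
  assumes rickart:
    "\<exists>p. p = star p \<and> p = p * p \<and> {x. x * a = 0} = {y * (1 - p) | y. True}"

definition lp :: "'a::rickart_star_ring \<Rightarrow> 'a" where
  "lp a = (THE p. p \<in> projections \<and> {x. x * a = 0} = {y * (1 - p) | y. True})"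

definition rp :: "'a::rickart_star_ring \<Rightarrow> 'a" where
  "rp a = (THE p. p \<in> projections \<and> {x. a * x = 0} = {(1 - p) * y | y. True})"

definition le_star_l :: "'a::rickart_star_ring \<Rightarrow> 'a \<Rightarrow> bool" where
  "le_star_l a b \<longleftrightarrow> lp a * b = a \<and> a = b * rp a \<and> a * a = a * b"

definition le_star_r :: "'a::rickart_star_ring \<Rightarrow> 'a \<Rightarrow> bool" where
  "le_star_r a b \<longleftrightarrow> lp a * b = a \<and> a = b * rp a \<and> a * a = b * a"

definition le_star_lr :: "'a::rickart_star_ring \<Rightarrow> 'a \<Rightarrow> bool" where
  "le_star_lr a b \<longleftrightarrow> lp a * b = a \<and> a = b * rp a \<and> a * a = a * b \<and> a * b = b * a"

definition br :: "'a::rickart_star_ring \<Rightarrow> 'a" where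
  "br b = rp b * b"

definition E_l :: "'a::rickart_star_ring \<Rightarrow> 'a set" where
  "E_l b = {p \<in> projections. proj_le p (rp b) \<and>
     p * star b * b = star b * b * p \<and> p * br b * p = p * br b}"

definition E_r :: "'a::rickart_star_ring \<Rightarrow> 'a set" where
  "E_r b = {p \<in> projections. proj_le p (rp b) \<and>
     p * star b * b = star b * b * p \<and> p * br b * p = br b * p}"

definition E_lr :: "'a::rickart_star_ring \<Rightarrow> 'a set" where
  "E_lr b = {p \<in> projections. proj_le p (rp b) \<and>
     p * star b * b = star b * b * p \<and> p * br b = br b * p}"

definition order_isomorphic ::
  "'a set \<Rightarrow> ('a \<Rightarrow> 'a \<Rightarrow> bool) \<Rightarrow> 'b set \<Rightarrow> ('b \<Rightarrow> 'b \<Rightarrow> bool) \<Rightarrow> bool" where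
  "order_isomorphic A le_A B le_B \<longleftrightarrow>
     (\<exists>f. bij_betw f A B \<and> monotone_on A le_A le_B f \<and> monotone_on B le_B le_A (inv_into A f))"

(* The remaining lemmas show that the descriptions defining lp and rp are proper. *)

lemma star_0: "star (0::'a::star_ring) = 0"
  using star_add[of "0::'a" 0] by simp

lemma star_diff: "star (a - b :: 'a::star_ring) = star a - star b"
  using star_add[of "a - b" b] by (simp add: algebra_simps)

lemma star_eq_0_iff: "star a = 0 \<longleftrightarrow> a = (0::'a::star_ring)"
  by (metis star_0 star_star)

lemma left_ideal_iff:
  fixes p :: "'a::rickart_star_ring"
  assumes "p = p * p"
  shows "x \<in> {y * (1 - p) | y. True} \<longleftrightarrow> x * p = 0"
proof
  assume "x \<in> {y * (1 - p) | y. True}"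
  then show "x * p = 0"
    using assms by (auto simp: mult.assoc left_diff_distrib)
next
  assume "x * p = 0"
  then have "x = x * (1 - p)"
    by (simp add: right_diff_distrib)
  then show "x \<in> {y * (1 - p) | y. True}"
    by blast
qed

lemma right_ideal_iff:
  fixes p :: "'a::rickart_star_ring"
  assumes "p = p * p"
  shows "x \<in> {(1 - p) * y | y. True} \<longleftrightarrow> p * x = 0"
proof
  assume "x \<in> {(1 - p) * y | y. True}"
  then show "p * x = 0"
    using assms by (auto simp: mult.assoc[symmetric] right_diff_distrib)
next
  assume "p * x = 0"
  then have "x = (1 - p) * x"
    by (simp add: left_diff_distrib)
  then show "x \<in> {(1 - p) * y | y. True}"
    by blast
qed

lemma projection_eqI:
  fixes p q :: "'a::rickart_star_ring"
  assumes "p \<in> projections" "q \<in> projections" "\<And>x. x * p = 0 \<longleftrightarrow> x * q = 0"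
  shows "p = q"
proof -
  have p: "p = star p" "p * p = p" and q: "q = star q" "q * q = q"
    using assms(1,2) by (auto simp: projections_def)
  have "(1 - p) * q = 0" "(1 - q) * p = 0"
    using assms(3)[of "1 - p"] assms(3)[of "1 - q"] p(2) q(2)
    by (simp_all add: left_diff_distrib)
  then have "q = p * q" "p = q * p"
    by (simp_all add: left_diff_distrib)
  then show ?thesis
    by (metis p(1) q(1) star_mult)
qed

lemma left_annihilator_iff:
  fixes p :: "'a::rickart_star_ring"
  assumes "p \<in> projections"
  shows "{x. x * a = 0} = {y * (1 - p) | y. True} \<longleftrightarrow> (\<forall>x. x * a = 0 \<longleftrightarrow> x * p = 0)"
  using left_ideal_iff[of p] assms unfolding projections_def by blast

lemma right_annihilator_iff:
  fixes p :: "'a::rickart_star_ring"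
  assumes "p \<in> projections"
  shows "{x. a * x = 0} = {(1 - p) * y | y. True} \<longleftrightarrow> (\<forall>x. x * star a = 0 \<longleftrightarrow> x * p = 0)"
proof -
  have p: "p = p * p" "star p = p"
    using assms by (auto simp: projections_def)
  have 1: "x * star a = 0 \<longleftrightarrow> a * star x = 0" "x * p = 0 \<longleftrightarrow> p * star x = 0" for x
    by (metis star_eq_0_iff star_mult star_star, metis p(2) star_eq_0_iff star_mult star_star)
  have "{x. a * x = 0} = {(1 - p) * y | y. True} \<longleftrightarrow> (\<forall>x. a * x = 0 \<longleftrightarrow> p * x = 0)"
    using right_ideal_iff[OF p(1)] by blast
  also have "\<dots> \<longleftrightarrow> (\<forall>x. a * star x = 0 \<longleftrightarrow> p * star x = 0)"
    by (metis star_star)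
  finally show ?thesis
    by (simp add: 1)
qed

lemma lp_ex1:
  fixes a :: "'a::rickart_star_ring"
  shows "\<exists>!p. p \<in> projections \<and> {x. x * a = 0} = {y * (1 - p) | y. True}"
proof (rule ex_ex1I)
  show "\<exists>p. p \<in> projections \<and> {x. x * a = 0} = {y * (1 - p) | y. True}"
    using rickart[of a] unfolding projections_def by blast
  fix p q
  assume p: "p \<in> projections \<and> {x. x * a = 0} = {y * (1 - p) | y. True}"
    and q: "q \<in> projections \<and> {x. x * a = 0} = {y * (1 - q) | y. True}"
  have "\<forall>x. x * a = 0 \<longleftrightarrow> x * p = 0"
    using p left_annihilator_iff[of p a] by simp
  moreover have "\<forall>x. x * a = 0 \<longleftrightarrow> x * q = 0"
    using q left_annihilator_iff[of q a] by simp
  ultimately show "p = q"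
    using p q by (intro projection_eqI) simp_all
qed

lemma rp_ex1:
  fixes a :: "'a::rickart_star_ring"
  shows "\<exists>!p. p \<in> projections \<and> {x. a * x = 0} = {(1 - p) * y | y. True}"
proof (rule ex_ex1I)
  obtain p where p: "p \<in> projections" "{x. x * star a = 0} = {y * (1 - p) | y. True}"
    using lp_ex1[of "star a"] by (elim ex1E conjE)
  then have "{x. a * x = 0} = {(1 - p) * y | y. True}"
    using left_annihilator_iff[of p "star a"] right_annihilator_iff[of p a] by simp
  with p(1) show "\<exists>p. p \<in> projections \<and> {x. a * x = 0} = {(1 - p) * y | y. True}"
    by (intro exI conjI)
next
  fix p q
  assume p: "p \<in> projections \<and> {x. a * x = 0} = {(1 - p) * y | y. True}"
    and q: "q \<in> projections \<and> {x. a * x = 0} = {(1 - q) * y | y. True}"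
  have "\<forall>x. x * star a = 0 \<longleftrightarrow> x * p = 0"
    using p right_annihilator_iff[of p a] by simp
  moreover have "\<forall>x. x * star a = 0 \<longleftrightarrow> x * q = 0"
    using q right_annihilator_iff[of q a] by simp
  ultimately show "p = q"
    using p q by (intro projection_eqI) simp_all
qed

end

theory Submission
  imports Defs
begin

text \<open>
  In all three parts the isomorphism is \<open>a \<mapsto> rp a\<close> with inverse \<open>p \<mapsto> b * p\<close>. The conditions
  \<open>lp a * b = a = b * rp a\<close> alone (the star order) correspond to the projections \<open>p\<close> below
  \<open>rp b\<close> that commute with \<open>star b * b\<close>. Since \<open>b * x = b * y\<close> holds iff
  \<open>rp b * x = rp b * y\<close>, the additional condition on \<open>b * p\<close> turns into the additional condition
  on \<open>p\<close> and \<open>br b\<close>.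
\<close>

definition star_le :: "'a::rickart_star_ring \<Rightarrow> 'a \<Rightarrow> bool" where
  "star_le a b \<longleftrightarrow> lp a * b = a \<and> a = b * rp a"

definition E_star :: "'a::rickart_star_ring \<Rightarrow> 'a set" where
  "E_star b = {p \<in> projections. proj_le p (rp b) \<and> p * star b * b = star b * b * p}"

section \<open>Annihilators and the projections \<open>lp\<close> and \<open>rp\<close>\<close>

lemma projectionsD:
  assumes "p \<in> projections"
  shows "star p = p" "p * p = p"
  using assms by (auto simp: projections_def)

lemma lp_projection: "lp a \<in> projections"
  and left_annihilator_lp: "x * a = 0 \<longleftrightarrow> x * lp a = 0"
proof -
  have *: "lp a \<in> projections \<and> {x. x * a = 0} = {y * (1 - lp a) | y. True}"
    unfolding lp_def by (rule theI') (rule lp_ex1)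
  then show "lp a \<in> projections" ..
  show "x * a = 0 \<longleftrightarrow> x * lp a = 0"
    using * left_annihilator_iff[of "lp a" a] by simp
qed

lemma rp_projection: "rp a \<in> projections"
  and right_annihilator_rp: "a * x = 0 \<longleftrightarrow> rp a * x = 0"
proof -
  have *: "rp a \<in> projections \<and> {x. a * x = 0} = {(1 - rp a) * y | y. True}"
    unfolding rp_def by (rule theI') (rule rp_ex1)
  then show "rp a \<in> projections" ..
  show "a * x = 0 \<longleftrightarrow> rp a * x = 0"
    using * right_ideal_iff[of "rp a" x] projectionsD(2)[of "rp a"] by auto
qed

text \<open>Applying \<open>star\<close> turns right annihilators of projections into left ones,
  which determine a projection by \<open>projection_eqI\<close>.\<close>

lemma rp_eqI:
  assumes "p \<in> projections" "\<And>x. a * x = 0 \<longleftrightarrow> p * x = 0"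
  shows "rp a = p"
proof (rule projection_eqI[OF rp_projection assms(1)])
  fix x
  have "x * rp a = 0 \<longleftrightarrow> rp a * star x = 0" "x * p = 0 \<longleftrightarrow> p * star x = 0"
    by (metis projectionsD(1) rp_projection star_eq_0_iff star_mult star_star,
        metis assms(1) projectionsD(1) star_eq_0_iff star_mult star_star)
  then show "x * rp a = 0 \<longleftrightarrow> x * p = 0"
    using assms(2) right_annihilator_rp by metis
qed

lemma lp_mult_self: "lp a * a = a"
proof -
  have "(1 - lp a) * a = 0"
    by (subst left_annihilator_lp) (simp add: left_diff_distrib projectionsD(2)[OF lp_projection])
  then show ?thesis
    by (simp add: left_diff_distrib)
qed

text \<open>The annihilator property for \<open>x - y\<close>. It serves as a cancellation law: a
  left factor \<open>a\<close> may be traded for \<open>rp a\<close>.\<close>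

lemma mult_left_eq_iff_rp: "a * x = a * y \<longleftrightarrow> rp a * x = rp a * y"
  using right_annihilator_rp[of a "x - y"] by (simp add: right_diff_distrib)

lemma mult_rp_self: "a * rp a = a"
  using mult_left_eq_iff_rp[of a "rp a" 1] projectionsD(2)[OF rp_projection[of a]] by simp

section \<open>The star order and the projections in \<open>E_star\<close>\<close>

lemma proj_le_commute:
  assumes "p \<in> projections" "q \<in> projections" "proj_le p q"
  shows "q * p = p"
  by (metis assms proj_le_def projectionsD(1) star_mult)

lemma star_le_imp_rp_le:
  assumes "star_le a b"
  shows "proj_le (rp a) (rp b)"
proof -
  have "a * rp b = a"
    using assms mult_rp_self[of b] unfolding star_le_def by (metis mult.assoc)
  then have "rp a * rp b = rp a"
    using mult_left_eq_iff_rp[of a "rp b" 1] by simp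
  then show ?thesis
    by (simp add: proj_le_def)
qed

text \<open>Both \<open>star b * b * rp a\<close> and \<open>star b * lp a * b\<close> equal
  \<open>star b * a\<close>. The second form is self-adjoint, so the first is too, and this is the
  required commutation.\<close>

lemma star_le_imp_rp_mem:
  assumes "star_le a b"
  shows "rp a \<in> E_star b"
proof -
  have eq: "star b * b * rp a = star b * lp a * b"
    using assms unfolding star_le_def by (metis mult.assoc)
  have "star (star b * lp a * b) = star b * lp a * b"
    using projectionsD(1)[OF lp_projection[of a]] by (simp add: star_mult star_star mult.assoc)
  then have "star (star b * b * rp a) = star b * b * rp a"
    by (simp add: eq)
  moreover have "star (star b * b * rp a) = rp a * star b * b"
    using projectionsD(1)[OF rp_projection[of a]] by (simp add: star_mult star_star mult.assoc)
  ultimately show ?thesis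
    using rp_projection star_le_imp_rp_le[OF assms] by (simp add: E_star_def)
qed

lemma rp_mult_projection:
  assumes "p \<in> projections" "proj_le p (rp b)"
  shows "rp (b * p) = p"
proof (rule rp_eqI[OF assms(1)])
  fix x
  have "b * (p * x) = 0 \<longleftrightarrow> rp b * (p * x) = 0"
    by (rule right_annihilator_rp)
  then show "b * p * x = 0 \<longleftrightarrow> p * x = 0"
    using proj_le_commute[OF assms(1) rp_projection assms(2)] by (metis mult.assoc)
qed

text \<open>By commutation, \<open>star b - p * star b\<close> annihilates \<open>b * p\<close> from
  the left, hence also \<open>lp (b * p)\<close>.\<close>

lemma lp_mult_projection:
  assumes "p \<in> projections" "p * star b * b = star b * b * p"
  shows "lp (b * p) * b = b * p"
proof -
  have "p * (star b * (b * p)) = p * star b * b * p"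
    by (simp only: mult.assoc)
  also have "\<dots> = star b * b * p * p"
    by (simp only: assms(2))
  also have "\<dots> = star b * (b * p)"
    using projectionsD(2)[OF assms(1)] by (simp add: mult.assoc)
  finally have "p * (star b * (b * p)) = star b * (b * p)" .
  then have "(star b - p * star b) * (b * p) = 0"
    by (simp add: left_diff_distrib mult.assoc)
  then have "(star b - p * star b) * lp (b * p) = 0"
    by (rule left_annihilator_lp[THEN iffD1])
  \<comment> \<open>Taking adjoints moves \<open>lp (b * p)\<close> to the left and turns the other
    factor into \<open>b - b * p\<close>.\<close>
  then have "star ((star b - p * star b) * lp (b * p)) = 0"
    by (simp add: star_0)
  then have "lp (b * p) * (b - b * p) = 0"
    by (simp add: star_mult star_diff star_star projectionsD(1)[OF lp_projection]
        projectionsD(1)[OF assms(1)])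
  then show ?thesis
    using lp_mult_self[of "b * p"] by (simp add: right_diff_distrib)
qed

lemma star_le_mult_projections:
  assumes "p \<in> E_star b" "q \<in> E_star b" "proj_le p q"
  shows "star_le (b * p) (b * q)"
proof -
  have "lp (b * p) * b = b * p" "rp (b * p) = p"
    using assms(1) lp_mult_projection rp_mult_projection by (auto simp: E_star_def)
  moreover have "p * q = p"
    using assms(3) by (simp add: proj_le_def)
  moreover have "q * p = p"
    using assms by (intro proj_le_commute) (simp_all add: E_star_def)
  ultimately show ?thesis
    unfolding star_le_def by (metis mult.assoc)
qed

lemma star_le_mult_projection:
  assumes "p \<in> E_star b"
  shows "star_le (b * p) b"
  using assms by (simp add: star_le_def E_star_def lp_mult_projection rp_mult_projection)

text \<open>On \<open>B\<close> an explicit two-sided inverse \<open>g\<close> agrees with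
  \<open>inv_into A f\<close>, so its monotonicity suffices.\<close>

lemma order_isomorphicI:
  assumes f: "\<And>a. a \<in> A \<Longrightarrow> f a \<in> B" and g: "\<And>b. b \<in> B \<Longrightarrow> g b \<in> A"
    and gf: "\<And>a. a \<in> A \<Longrightarrow> g (f a) = a" and fg: "\<And>b. b \<in> B \<Longrightarrow> f (g b) = b"
    and f_mono: "monotone_on A le_A le_B f" and g_mono: "monotone_on B le_B le_A g"
  shows "order_isomorphic A le_A B le_B"
proof -
  have bij: "bij_betw f A B"
    using f g gf fg by (intro bij_betw_byWitness[where f' = g]) auto
  have "inv_into A f b = g b" if "b \<in> B" for b
    using that bij g fg by (intro inv_into_f_eq) (auto simp: bij_betw_def)
  then have "monotone_on B le_B le_A (inv_into A f)"
    using g_mono by (simp add: monotone_on_def)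
  with bij f_mono show ?thesis
    unfolding order_isomorphic_def by blast
qed

text \<open>The argument common to all three parts, for an order \<open>le\<close> refining the star
  order: \<open>mem\<close> identifies the image of \<open>rp\<close>, and \<open>mono\<close> makes
  the inverse monotone.\<close>

lemma order_isomorphic_star_refinement:
  assumes star: "\<And>a c. le a c \<Longrightarrow> star_le a c"
    and sub: "E \<subseteq> E_star b"
    and mem: "\<And>p. p \<in> E_star b \<Longrightarrow> le (b * p) b \<longleftrightarrow> p \<in> E"
    and mono: "\<And>p q. p \<in> E \<Longrightarrow> q \<in> E \<Longrightarrow> proj_le p q \<Longrightarrow> le (b * p) (b * q)"
  shows "order_isomorphic {a. le a b} le E proj_le"
proof (rule order_isomorphicI[where f = rp and g = "\<lambda>p. b * p"])
  fix a assume "a \<in> {a. le a b}"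
  then have a: "le a b" "star_le a b"
    using star by auto
  then show eq: "b * rp a = a"
    by (simp add: star_le_def)
  show "rp a \<in> E"
    using mem[OF star_le_imp_rp_mem[OF a(2)]] a(1) by (simp add: eq)
next
  fix p assume "p \<in> E"
  with sub show "b * p \<in> {a. le a b}" "rp (b * p) = p"
    using mem rp_mult_projection by (auto simp: E_star_def)
next
  show "monotone_on {a. le a b} le proj_le rp"
    using star star_le_imp_rp_le by (auto simp: monotone_on_def)
  show "monotone_on E proj_le le (\<lambda>p. b * p)"
    using mono by (auto simp: monotone_on_def)
qed

section \<open>Translating the conditions on squares into conditions on \<open>br b\<close>\<close>

lemma E_star_br:
  assumes "p \<in> E_star b"
  shows "rp b * p = p" "p * br b = p * b"
proof -
  have p: "p \<in> projections" "proj_le p (rp b)"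
    using assms by (auto simp: E_star_def)
  show "rp b * p = p"
    by (rule proj_le_commute[OF p(1) rp_projection p(2)])
  show "p * br b = p * b"
    using p(2) unfolding br_def proj_le_def by (metis mult.assoc)
qed

text \<open>Cancelling the leading \<open>b\<close> leaves a factor \<open>rp b\<close>, which
  \<open>p\<close> absorbs on both sides.\<close>

lemma square_eq_right_iff:
  assumes "p \<in> E_star b"
  shows "b * p * (b * p) = b * p * b \<longleftrightarrow> p * br b * p = p * br b"
proof -
  have "b * (p * b * p) = b * (p * b) \<longleftrightarrow> rp b * (p * b * p) = rp b * (p * b)"
    by (rule mult_left_eq_iff_rp)
  also have "\<dots> \<longleftrightarrow> p * b * p = p * b"
    by (simp add: mult.assoc[symmetric] E_star_br(1)[OF assms])
  finally show ?thesis
    by (simp add: E_star_br(2)[OF assms] mult.assoc)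
qed

text \<open>After cancelling the leading \<open>b\<close>, the right side has no \<open>p\<close> to
  absorb \<open>rp b\<close>; the product \<open>rp b * b\<close> that remains is
  \<open>br b\<close>.\<close>

lemma square_eq_left_iff:
  assumes "p \<in> E_star b"
  shows "b * p * (b * p) = b * (b * p) \<longleftrightarrow> p * br b * p = br b * p"
proof -
  have "b * (p * b * p) = b * (b * p) \<longleftrightarrow> rp b * (p * b * p) = rp b * (b * p)"
    by (rule mult_left_eq_iff_rp)
  also have "\<dots> \<longleftrightarrow> p * b * p = br b * p"
    by (simp add: br_def mult.assoc[symmetric] E_star_br(1)[OF assms])
  finally show ?thesis
    by (simp add: E_star_br(2)[OF assms] mult.assoc)
qed

lemma le_star_l_iff: "le_star_l a b \<longleftrightarrow> star_le a b \<and> a * a = a * b"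
  by (auto simp: le_star_l_def star_le_def)

lemma le_star_r_iff: "le_star_r a b \<longleftrightarrow> star_le a b \<and> a * a = b * a"
  by (auto simp: le_star_r_def star_le_def)

lemma le_star_lr_iff: "le_star_lr a b \<longleftrightarrow> le_star_l a b \<and> le_star_r a b"
  by (auto simp: le_star_lr_def le_star_l_def le_star_r_def)

lemma E_l_iff: "p \<in> E_l b \<longleftrightarrow> p \<in> E_star b \<and> p * br b * p = p * br b"
  unfolding E_l_def E_star_def by blast

lemma E_r_iff: "p \<in> E_r b \<longleftrightarrow> p \<in> E_star b \<and> p * br b * p = br b * p"
  unfolding E_r_def E_star_def by blast

text \<open>If \<open>p\<close> commutes with \<open>br b\<close>, idempotence gives both one-sided
  equations; conversely, these share the side \<open>p * br b * p\<close>.\<close>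

lemma E_lr_iff: "p \<in> E_lr b \<longleftrightarrow> p \<in> E_l b \<and> p \<in> E_r b"
proof -
  have "p * br b = br b * p \<longleftrightarrow> p * br b * p = p * br b \<and> p * br b * p = br b * p"
    if "p \<in> projections"
  proof
    assume "p * br b = br b * p"
    then show "p * br b * p = p * br b \<and> p * br b * p = br b * p"
      using projectionsD(2)[OF that] by (simp add: mult.assoc)
  qed metis
  then show ?thesis
    unfolding E_lr_def E_l_def E_r_def by blast
qed

lemma le_star_l_mult_projection_iff:
  assumes "p \<in> E_star b"
  shows "le_star_l (b * p) b \<longleftrightarrow> p \<in> E_l b"
  using assms star_le_mult_projection square_eq_right_iff by (auto simp: le_star_l_iff E_l_iff)

lemma le_star_r_mult_projection_iff:
  assumes "p \<in> E_star b"
  shows "le_star_r (b * p) b \<longleftrightarrow> p \<in> E_r b"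
  using assms star_le_mult_projection square_eq_left_iff by (auto simp: le_star_r_iff E_r_iff)

text \<open>Multiplying \<open>b * p * (b * p) = b * p * b\<close> by \<open>q\<close> on the right
  leaves the left side unchanged, since \<open>p * q = p\<close>.\<close>

lemma le_star_l_mult_projections:
  assumes p: "p \<in> E_l b" and q: "q \<in> E_star b" and "proj_le p q"
  shows "le_star_l (b * p) (b * q)"
proof -
  have "p * q = p"
    using assms(3) by (simp add: proj_le_def)
  moreover have "b * p * (b * p) = b * p * b"
    using p square_eq_right_iff by (auto simp: E_l_iff)
  ultimately have "b * p * (b * p) = b * p * (b * q)"
    by (metis mult.assoc)
  then show ?thesis
    using assms star_le_mult_projections by (auto simp: le_star_l_iff E_l_iff)
qed

lemma le_star_r_mult_projections:
  assumes p: "p \<in> E_r b" and q: "q \<in> E_star b" and "proj_le p q"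
  shows "le_star_r (b * p) (b * q)"
proof -
  have qp: "q * p = p"
    using assms proj_le_commute[of p q] by (auto simp: E_r_iff E_star_def)
  have pb: "p * b * p = br b * p"
    using p E_star_br(2)[of p b] by (auto simp: E_r_iff)
  \<comment> \<open>Passing from \<open>b\<close> to \<open>br b\<close> behind \<open>q\<close>
    makes the condition on \<open>p\<close> applicable; then \<open>q\<close> is absorbed by
    \<open>p\<close>.\<close>
  have "q * b * p = q * br b * p"
    using E_star_br(2)[OF q] by simp
  also have "\<dots> = q * (p * b * p)"
    unfolding pb by (rule mult.assoc)
  also have "\<dots> = p * b * p"
    by (simp add: qp mult.assoc[symmetric])
  finally have "b * p * (b * p) = b * q * (b * p)"
    by (simp add: mult.assoc)
  then show ?thesis
    using assms star_le_mult_projections by (auto simp: le_star_r_iff E_r_iff)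
qed

theorem theorem32:
  fixes b :: "'a::rickart_star_ring"
  shows "order_isomorphic {a. le_star_l a b} le_star_l (E_l b) proj_le \<and>
    order_isomorphic {a. le_star_r a b} le_star_r (E_r b) proj_le \<and>
    order_isomorphic {a. le_star_lr a b} le_star_lr (E_lr b) proj_le"
proof (intro conjI)
  have l: "le_star_l a c \<Longrightarrow> star_le a c" and r: "le_star_r a c \<Longrightarrow> star_le a c" for a c :: 'a
    by (simp_all add: le_star_l_iff le_star_r_iff)
  have El: "E_l b \<subseteq> E_star b" and Er: "E_r b \<subseteq> E_star b"
    by (auto simp: E_l_iff E_r_iff)
  show "order_isomorphic {a. le_star_l a b} le_star_l (E_l b) proj_le"
    using l El le_star_l_mult_projection_iff le_star_l_mult_projections
    by (intro order_isomorphic_star_refinement) blast+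
  show "order_isomorphic {a. le_star_r a b} le_star_r (E_r b) proj_le"
    using r Er le_star_r_mult_projection_iff le_star_r_mult_projections
    by (intro order_isomorphic_star_refinement) blast+
  show "order_isomorphic {a. le_star_lr a b} le_star_lr (E_lr b) proj_le"
  \<comment> \<open>The order is the conjunction of the one-sided orders and \<open>E_lr b\<close>
    the intersection of \<open>E_l b\<close> and \<open>E_r b\<close>, so every premise follows from
    the one-sided facts.\<close>
  proof (rule order_isomorphic_star_refinement)
    show "E_lr b \<subseteq> E_star b"
      using El E_lr_iff by blast
    show "le_star_lr a c \<Longrightarrow> star_le a c" for a c :: 'a
      using l le_star_lr_iff by blast
    show "le_star_lr (b * p) b \<longleftrightarrow> p \<in> E_lr b" if "p \<in> E_star b" for p
      using that
      by (simp add: le_star_lr_iff E_lr_iff le_star_l_mult_projection_iff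
          le_star_r_mult_projection_iff)
    show "le_star_lr (b * p) (b * q)" if "p \<in> E_lr b" "q \<in> E_lr b" "proj_le p q" for p q
      using that subsetD[OF El] le_star_l_mult_projections le_star_r_mult_projections
      unfolding le_star_lr_iff E_lr_iff by blast
  qed
qed

end
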